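(* Let $L\in\mathbb{N}$ and $\Omega=\{1,\dots,L\}$. Let $F,\tilde F\in\mathbb{R}^{L\times L}$ be stochastic matrices, let $S\in\mathbb{R}^{L\times L}$ be substochastic and irreducible, and assume that $F\ge S$ and $\tilde F\ge S$ entrywise. Then for every $m\in\Omega$, $$\left|\log \pi_m(\tilde F)-\log\pi_m(F)\right|\le \sum_{\substack{i,j\in\Omega\\ i\ne j}}\frac{\left|\tilde F_{ij}-F_{ij}\right|}{\mathbf{Q}_{ij}(S)}.$$
   Context: A matrix is stochastic if its entries are nonnegative and every row sums to $1$; it is substochastic if its entries are nonnegative and every row sums to at most $1$ (stochastic $S$ is allowed). Inequalities between matrices are entrywise. For an irreducible stochastic matrix $G\in\mathbb{R}^{L\times L}$, $\pi(G)\in\mathbb{R}^L$ denotes its invariant distribution, i.e. the unique vector with $\pi(G)^{\mathrm t}G=\pi(G)^{\mathrm t}$ and $\sum_i\pi_i(G)=1$; all its entries are positive. (Since $S$ is irreducible and $F,\tilde F\ge S$, the matrices $F,\tilde F$ are irreducible.) Definition of $\mathbf{Q}_{ij}(S)$: let $X^\omega$ be the discrete time Markov chain on $\Omega\cup\{\omega\}$, with $\omega\notin\Omega$ an additional absorbing state, whose transition matrix $S^\omega$ is given by $S^\omega_{kl}=S_{kl}$ for $k,l\in\Omega$, $S^\omega_{k\omega}=1-\sum_{l\in\Omega}S_{kl}$ for $k\in\Omega$, $S^\omega_{\omega k}=0$ for $k\in\Omega$, and $S^\omega_{\omega\omega}=1$. For a state $k$, let $\tau_k=\min\{s>0: X^\omega_s=k\}$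 (with $\min\emptyset=\infty$). For $i,j\in\Omega$ with $i\neq j$, $$\mathbf{Q}_{ij}(S):=\mathbf{P}\left[\tau_j<\min\{\tau_i,\tau_\omega\}\,\middle|\,X^\omega_0=i\right],$$ which is strictly positive for irreducible $S$. *)

theory Defs
  imports "HOL-Probability.Probability"
begin

definition substochastic :: "real ^ 'n ^ 'n \<Rightarrow> bool" where
  "substochastic A \<longleftrightarrow> (\<forall>i j. 0 \<le> A $ i $ j) \<and> (\<forall>i. (\<Sum>j\<in>UNIV. A $ i $ j) \<le> 1)"

definition stochastic :: "real ^ 'n ^ 'n \<Rightarrow> bool" where
  "stochastic A \<longleftrightarrow> (\<forall>i j. 0 \<le> A $ i $ j) \<and> (\<forall>i. (\<Sum>j\<in>UNIV. A $ i $ j) = 1)"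

text \<open>Irreducibility: the directed graph of the nonzero entries is strongly connected. Paths of
  length zero are allowed, so every 1 x 1 matrix is irreducible.\<close>

definition irreducible_matrix :: "real ^ 'n ^ 'n \<Rightarrow> bool" where
  "irreducible_matrix A \<longleftrightarrow> (\<forall>i j. (i, j) \<in> {(k, l). A $ k $ l \<noteq> 0}\<^sup>*)"

definition invariant_distribution :: "real ^ 'n ^ 'n \<Rightarrow> real ^ 'n" where
  "invariant_distribution G = (THE p. p v* G = p \<and> (\<Sum>i\<in>UNIV. p $ i) = 1)"

text \<open>The law, on the space of sequences of states, of the discrete time Markov chain with
  transition matrix \<open>P\<close> started at \<open>i\<close>. It is realised by independent random moves: \<open>\<xi> (n, k)\<close>, with
  distribution \<open>P k\<close>, is the state that the chain visits at time \<open>n + 1\<close> if it is in \<open>k\<close> at time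
  \<open>n\<close>. The usual formula for the finite-dimensional distributions, which determines the law, is
  \<open>markov_law_cylinder\<close>.\<close>

primrec trajectory :: "'s \<Rightarrow> (nat \<times> 's \<Rightarrow> 's) \<Rightarrow> nat \<Rightarrow> 's" where
  "trajectory i \<xi> 0 = i"
| "trajectory i \<xi> (Suc n) = \<xi> (n, trajectory i \<xi> n)"

definition random_moves :: "('s \<Rightarrow> 's \<Rightarrow> real) \<Rightarrow> (nat \<times> 's \<Rightarrow> 's) measure" where
  "random_moves P = (\<Pi>\<^sub>M (n, k) \<in> UNIV. measure_pmf (embed_pmf (P k)))"

definition markov_law :: "('s \<Rightarrow> 's \<Rightarrow> real) \<Rightarrow> 's \<Rightarrow> (nat \<Rightarrow> 's) measure" where
  "markov_law P i =
     distr (random_moves P) (\<Pi>\<^sub>M n\<in>UNIV. count_space UNIV) (trajectory i)"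

lemma space_random_moves: "space (random_moves P) = UNIV"
  by (auto simp: random_moves_def space_PiM split: prod.splits)

lemma prob_space_random_moves: "prob_space (random_moves P)"
  unfolding random_moves_def
  by (rule prob_space_PiM) (auto simp: measure_pmf.prob_space_axioms split: prod.splits)

lemma measurable_trajectory [measurable]:
  fixes P :: "'s::countable \<Rightarrow> 's \<Rightarrow> real"
  shows "trajectory i \<in> random_moves P \<rightarrow>\<^sub>M (\<Pi>\<^sub>M n\<in>UNIV. count_space UNIV)"
proof -
  have move: "(\<lambda>\<xi>. \<xi> (n, k)) \<in> random_moves P \<rightarrow>\<^sub>M count_space UNIV" for n k
  proof -
    have "(\<lambda>\<xi>. \<xi> (n, k)) \<in> random_moves P \<rightarrow>\<^sub>M measure_pmf (embed_pmf (P k))"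
      using measurable_component_singleton[of "(n, k)" UNIV
          "\<lambda>(n, k). measure_pmf (embed_pmf (P k))"]
      by (simp add: random_moves_def)
    then show ?thesis
      by (subst measurable_cong_sets[OF refl sets_measure_pmf_count_space[symmetric]])
  qed
  have "(\<lambda>\<xi>. trajectory i \<xi> n) \<in> random_moves P \<rightarrow>\<^sub>M count_space UNIV" for n
  proof (induction n)
    case (Suc n)
    show ?case
      using measurable_compose_countable[OF move[of n] Suc.IH] by simp
  qed simp
  then show ?thesis
    by (intro measurable_PiM_single') (auto simp: space_PiM)
qed

lemma prob_space_markov_law:
  fixes P :: "'s::countable \<Rightarrow> 's \<Rightarrow> real"
  shows "prob_space (markov_law P i)"
  unfolding markov_law_def
  by (rule prob_space.prob_space_distr[OF prob_space_random_moves measurable_trajectory])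

lemma markov_law_cylinder:
  fixes P :: "'s::finite \<Rightarrow> 's \<Rightarrow> real"
  assumes nonneg: "\<And>k l. 0 \<le> P k l" and sum1: "\<And>k. (\<Sum>l\<in>UNIV. P k l) = 1"
  shows "measure (markov_law P i) {X. \<forall>k\<le>n. X k = x k} =
           (if x 0 = i then \<Prod>k<n. P (x k) (x (Suc k)) else 0)"
proof -
  let ?M = "\<lambda>(n::nat, k). measure_pmf (embed_pmf (P k))"
  interpret product_prob_space ?M UNIV
    by unfold_locales (auto simp: measure_pmf.emeasure_space_1 split: prod.splits
          intro: measure_pmf.sigma_finite_countable)
  have pmf: "pmf (embed_pmf (P k)) l = P k l" for k l
    using nonneg sum1[of k]
    by (subst pmf_embed_pmf) (auto simp: nn_integral_count_space_finite sum_ennreal)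
  have "{X. \<forall>k\<le>n. X k = x k} \<in> sets (\<Pi>\<^sub>M n\<in>UNIV. count_space (UNIV :: 's set))"
  proof -
    have "{X \<in> space (\<Pi>\<^sub>M n\<in>UNIV. count_space (UNIV :: 's set)). \<forall>k\<in>{..n}. X k = x k}
            \<in> sets (\<Pi>\<^sub>M n\<in>UNIV. count_space UNIV)"
      by measurable
    then show ?thesis by (simp add: space_PiM atMost_def)
  qed
  then have "measure (markov_law P i) {X. \<forall>k\<le>n. X k = x k} =
      measure (random_moves P) {\<xi>. \<forall>k\<le>n. trajectory i \<xi> k = x k}"
    unfolding markov_law_def
    by (subst measure_distr[OF measurable_trajectory]) (auto simp: space_random_moves vimage_def)
  also have "{\<xi>. \<forall>k\<le>n. trajectory i \<xi> k = x k} =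
      (if x 0 = i then {\<xi>. \<forall>k<n. \<xi> (k, x k) = x (Suc k)} else {})"
  proof -
    have "(\<forall>k\<le>n. trajectory i \<xi> k = x k) \<longleftrightarrow> x 0 = i \<and> (\<forall>k<n. \<xi> (k, x k) = x (Suc k))" for \<xi>
    proof (induction n)
      case (Suc n)
      then show ?case by (auto simp: le_Suc_eq less_Suc_eq)
    qed auto
    then show ?thesis by auto
  qed
  also have "measure (random_moves P) \<dots> =
      (if x 0 = i then \<Prod>k<n. P (x k) (x (Suc k)) else 0)"
  proof (cases "x 0 = i")
    case True
    let ?J = "(\<lambda>k. (k, x k)) ` {..<n}"
    have inj: "inj_on (\<lambda>k. (k, x k)) {..<n}" by (auto simp: inj_on_def)
    have "emeasure (random_moves P) {\<xi>. \<forall>k<n. \<xi> (k, x k) = x (Suc k)} =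
        emeasure (PiM UNIV ?M) {\<xi> \<in> space (PiM UNIV ?M). \<forall>j\<in>?J. \<xi> j \<in> {x (Suc (fst j))}}"
      using space_random_moves[of P] by (auto simp: random_moves_def intro!: arg_cong2[of _ _ _ _ emeasure])
    also have "\<dots> = (\<Prod>j\<in>?J. emeasure (?M j) {x (Suc (fst j))})"
      by (rule emeasure_PiM_Collect) (auto split: prod.splits)
    also have "\<dots> = ennreal (\<Prod>k<n. P (x k) (x (Suc k)))"
      by (simp add: prod.reindex[OF inj] emeasure_pmf_single pmf prod_ennreal nonneg)
    finally show ?thesis
      using True nonneg by (simp add: measure_def prod_nonneg)
  qed simp
  finally show ?thesis .
qed

definition return_time :: "'s \<Rightarrow> (nat \<Rightarrow> 's) \<Rightarrow> enat" where
  "return_time k X = (INF s\<in>{s. 0 < s \<and> X s = k}. enat s)"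

text \<open>The state space extended by the additional absorbing state is \<open>'n option\<close>, with \<open>None\<close> as the
  absorbing state.\<close>

fun absorbing_extension :: "real ^ 'n ^ 'n \<Rightarrow> 'n option \<Rightarrow> 'n option \<Rightarrow> real" where
  "absorbing_extension S (Some k) (Some l) = S $ k $ l"
| "absorbing_extension S (Some k) None = 1 - (\<Sum>l\<in>UNIV. S $ k $ l)"
| "absorbing_extension S None (Some l) = 0"
| "absorbing_extension S None None = 1"

lemma measurable_return_time [measurable]:
  "return_time k \<in> (\<Pi>\<^sub>M n\<in>UNIV. count_space (UNIV :: 's::countable set)) \<rightarrow>\<^sub>M count_space UNIV"
proof -
  have "return_time k = (\<lambda>X. INF s. if 0 < s \<and> X s = k then enat s else \<infinity>)"
    unfolding return_time_def
  proof (rule ext, rule antisym)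
    fix X :: "nat \<Rightarrow> 's"
    show "(INF s\<in>{s. 0 < s \<and> X s = k}. enat s) \<le> (INF s. if 0 < s \<and> X s = k then enat s else \<infinity>)"
      by (rule INF_greatest) (simp add: INF_lower)
    show "(INF s. if 0 < s \<and> X s = k then enat s else \<infinity>) \<le> (INF s\<in>{s. 0 < s \<and> X s = k}. enat s)"
      by (rule INF_mono) force
  qed
  also have "\<dots> \<in> (\<Pi>\<^sub>M n\<in>UNIV. count_space (UNIV :: 's set)) \<rightarrow>\<^sub>M count_space UNIV"
    by measurable
  finally show ?thesis .
qed

definition Q_prob :: "real ^ 'n ^ 'n \<Rightarrow> 'n \<Rightarrow> 'n \<Rightarrow> real" where
  "Q_prob S i j = measure (markov_law (absorbing_extension S) (Some i))
     {X. return_time (Some j) X < min (return_time (Some i) X) (return_time None X)}"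

end

theory Submission
  imports Defs
begin

text \<open>
  The comparison needs no differentiation: moving mass within one row of a stochastic matrix has an
  explicit effect on the invariant distribution.

  Let \<open>G\<close> be irreducible with invariant distribution \<open>p\<close>, let \<open>i \<noteq> j\<close>, and let \<open>r k\<close> be the probability
  that the time reversal of the chain, started at \<open>k\<close>, reaches \<open>i\<close> before \<open>j\<close>. The vector \<open>u\<close> with entries
  \<open>p\<^sub>k r k\<close> is invariant under \<open>G\<close> except that it has a source at \<open>i\<close> and a sink at \<open>j\<close>, both of strength
  \<open>p\<^sub>i Q\<close>, where \<open>Q\<close> is the probability that \<open>G\<close> started at \<open>i\<close> reaches \<open>j\<close> before returning to \<open>i\<close>
  (\<open>flux_between_states\<close>). If mass \<open>d \<ge> 0\<close> is moved from the entry \<open>(i, i)\<close> to the entry \<open>(i, j)\<close>, the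
  invariance defect of \<open>p\<close> has the same shape, so a multiple of \<open>u\<close> corrects it: with \<open>e = d / Q\<close>, the
  new invariant distribution is proportional to \<open>p + e (p - u)\<close>. As \<open>0 \<le> r \<le> 1\<close>, the factor
  \<open>1 + e (1 - r m)\<close> and the normalising constant, which is the \<open>p\<close>-average of these factors, both lie
  between \<open>1\<close> and \<open>1 + e\<close>, so the logarithm of every entry changes by at most \<open>ln (1 + e) \<le> e\<close>
  (\<open>ln_invariant_distribution_move_mass\<close>).

  This estimate becomes uniform through \<open>Q_prob_le\<close>: \<open>Q\<close> is at least the corresponding probability for
  any \<open>S \<le> G\<close>, because a killed chain has fewer ways to reach \<open>j\<close>; irreducibility of \<open>S\<close> makes the latter
  positive (\<open>Q_prob_pos\<close>).

  Finally, let \<open>G\<close> agree off the diagonal with the entrywise minimum of the two given matrices, the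
  diagonal being adjusted to make the rows sum to one. Both given matrices arise from \<open>G\<close> by moving
  mass away from the diagonal, one entry at a time, and no intermediate matrix falls below \<open>S\<close>
  (\<open>ln_invariant_distribution_increase\<close>). The excesses of two numbers over their minimum add up to the
  absolute value of their difference, so the two estimates sum to the bound.
\<close>

section \<open>Invariant distributions of irreducible stochastic matrices\<close>

lemma invariant_iff:
  fixes G :: "real ^ 'n ^ 'n"
  shows "p v* G = p \<longleftrightarrow> (\<forall>l. (\<Sum>k\<in>UNIV. p $ k * G $ k $ l) = p $ l)"
  by (simp add: vector_matrix_mult_def vec_eq_iff)

lemma stochastic_nonneg: "stochastic G \<Longrightarrow> 0 \<le> G $ k $ l"
  and stochastic_row_sum: "stochastic G \<Longrightarrow> (\<Sum>l\<in>UNIV. G $ k $ l) = 1"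
  by (auto simp: stochastic_def)

lemma irreducible_matrix_mono:
  assumes "irreducible_matrix S" and "substochastic S" and "S \<le> G"
  shows "irreducible_matrix G"
proof -
  have "G $ k $ l \<noteq> 0" if "S $ k $ l \<noteq> 0" for k l
  proof -
    have "0 \<le> S $ k $ l" "S $ k $ l \<le> G $ k $ l"
      using assms by (auto simp: substochastic_def less_eq_vec_def)
    then show ?thesis using that by linarith
  qed
  then have "{(k, l). S $ k $ l \<noteq> 0}\<^sup>* \<subseteq> {(k, l). G $ k $ l \<noteq> 0}\<^sup>*"
    by (intro rtrancl_mono) auto
  then show ?thesis
    using assms(1) unfolding irreducible_matrix_def by blast
qed

text \<open>The constant vector lies in the kernel of \<open>I - G\<close>, so the square matrix \<open>I - G\<close> is singular and has
  a left kernel as well.\<close>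

lemma stochastic_has_invariant_vector:
  fixes G :: "real ^ 'n ^ 'n"
  assumes "stochastic G"
  obtains x where "x \<noteq> 0" and "x v* G = x"
proof -
  let ?A = "mat 1 - G"
  have "?A *v 1 = 0"
    using stochastic_row_sum[OF assms]
    by (simp add: vec_eq_iff matrix_vector_mult_def sum_subtractf mat_def)
  then have "\<nexists>B. B ** ?A = mat 1"
    unfolding matrix_left_invertible_ker by (metis one_neq_zero)
  then have "\<nexists>B. ?A ** B = mat 1"
    using matrix_left_right_inverse by blast
  then have "\<nexists>B. B ** transpose ?A = mat 1"
    by (metis matrix_transpose_mul transpose_mat transpose_transpose)
  then obtain x where "x \<noteq> 0" "transpose ?A *v x = 0"
    unfolding matrix_left_invertible_ker by blast
  moreover from this have "x v* G = x"
    by (simp add: transpose_matrix_vector vector_matrix_mult_diff_rdistrib)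
  ultimately show ?thesis using that by blast
qed

text \<open>The triangle inequality gives \<open>\<bar>x\<bar> \<le> \<bar>x\<bar> G\<close> entrywise. Both sides have the same total mass, since the
  rows of \<open>G\<close> sum to one, so the inequality is an equality in each entry.\<close>

lemma invariant_abs:
  fixes G :: "real ^ 'n ^ 'n"
  assumes G: "stochastic G" and x: "x v* G = x"
  shows "(\<chi> k. \<bar>x $ k\<bar>) v* G = (\<chi> k. \<bar>x $ k\<bar>)"
proof -
  have le: "\<bar>x $ l\<bar> \<le> (\<Sum>k\<in>UNIV. \<bar>x $ k\<bar> * G $ k $ l)" for l
  proof -
    have "\<bar>x $ l\<bar> = \<bar>\<Sum>k\<in>UNIV. x $ k * G $ k $ l\<bar>"
      using x by (simp add: invariant_iff)
    also have "\<dots> \<le> (\<Sum>k\<in>UNIV. \<bar>x $ k * G $ k $ l\<bar>)" by (rule sum_abs)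
    also have "\<dots> = (\<Sum>k\<in>UNIV. \<bar>x $ k\<bar> * G $ k $ l)"
      by (simp add: abs_mult stochastic_nonneg[OF G])
    finally show ?thesis .
  qed
  have "(\<Sum>l\<in>UNIV. \<Sum>k\<in>UNIV. \<bar>x $ k\<bar> * G $ k $ l) = (\<Sum>k\<in>UNIV. \<bar>x $ k\<bar>)"
    by (subst sum.swap) (simp add: sum_distrib_left[symmetric] stochastic_row_sum[OF G])
  then have "(\<Sum>k\<in>UNIV. \<bar>x $ k\<bar> * G $ k $ l) = \<bar>x $ l\<bar>" for l
    using sum_mono_inv[of "\<lambda>l. \<bar>x $ l\<bar>" UNIV "\<lambda>l. \<Sum>k\<in>UNIV. \<bar>x $ k\<bar> * G $ k $ l" l] le by simp
  then show ?thesis by (simp add: invariant_iff)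
qed

text \<open>Positivity spreads along the edges of the graph of \<open>G\<close>.\<close>

lemma invariant_nonneg_imp_pos:
  fixes G :: "real ^ 'n ^ 'n"
  assumes G: "stochastic G" and irr: "irreducible_matrix G"
    and x: "x v* G = x" and nonneg: "\<And>k. 0 \<le> x $ k" and "x $ a > 0"
  shows "x $ l > 0"
proof -
  have "(a, l) \<in> {(k, l). G $ k $ l \<noteq> 0}\<^sup>*"
    using irr by (simp add: irreducible_matrix_def)
  then show ?thesis
  proof (induction rule: rtrancl_induct)
    case base
    show ?case by fact
  next
    case (step y z)
    have "0 < x $ y * G $ y $ z"
      using step stochastic_nonneg[OF G, of y z] by (simp add: less_le)
    also have "\<dots> \<le> (\<Sum>k\<in>UNIV. x $ k * G $ k $ z)"
      by (rule member_le_sum) (auto simp: nonneg stochastic_nonneg[OF G])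
    also have "\<dots> = x $ z" using x by (simp add: invariant_iff)
    finally show ?case .
  qed
qed

text \<open>Uniqueness up to scaling among all real vectors, not just the nonnegative ones: if \<open>x\<close> has a positive
  entry, then \<open>\<bar>x\<bar> + x\<close> is a nonzero nonnegative invariant vector, hence positive throughout, which
  forces \<open>x\<close> itself to be positive.\<close>

lemma invariant_sum_zero_imp_zero:
  fixes G :: "real ^ 'n ^ 'n"
  assumes G: "stochastic G" and irr: "irreducible_matrix G"
    and x: "x v* G = x" and sum: "(\<Sum>k\<in>UNIV. x $ k) = 0"
  shows "x = 0"
proof (rule ccontr)
  assume "x \<noteq> 0"
  let ?a = "\<chi> k. \<bar>x $ k\<bar>"
  have inv: "(?a + x) v* G = ?a + x"
    using invariant_abs[OF G x] x by (simp add: vector_matrix_left_distrib)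
  have "\<exists>k. x $ k > 0"
  proof (rule ccontr)
    assume "\<nexists>k. x $ k > 0"
    then have "\<And>k. 0 \<le> - x $ k" by (simp add: not_less)
    moreover have "(\<Sum>k\<in>UNIV. - x $ k) = 0" using sum by (simp add: sum_negf)
    ultimately have "\<forall>k\<in>UNIV. - x $ k = 0" by (subst (asm) sum_nonneg_eq_0_iff) auto
    then show False using \<open>x \<noteq> 0\<close> by (simp add: vec_eq_iff)
  qed
  then obtain a where "x $ a > 0" ..
  then have "(?a + x) $ a > 0" by simp
  moreover have "0 \<le> (?a + x) $ k" for k by simp
  ultimately have pos: "(?a + x) $ k > 0" for k
    using invariant_nonneg_imp_pos[OF G irr inv] by blast
  have "x $ k > 0" for k using pos[of k] by (simp add: abs_if split: if_splits)
  then have "(\<Sum>k\<in>UNIV. x $ k) > 0" by (intro sum_pos) auto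
  with sum show False by simp
qed

lemma invariant_distribution_eqI:
  fixes G :: "real ^ 'n ^ 'n"
  assumes G: "stochastic G" and irr: "irreducible_matrix G"
    and p: "p v* G = p" "(\<Sum>k\<in>UNIV. p $ k) = 1"
  shows "invariant_distribution G = p"
  unfolding invariant_distribution_def
proof (rule the_equality)
  fix y :: "real ^ 'n" assume y: "y v* G = y \<and> (\<Sum>k\<in>UNIV. y $ k) = 1"
  have "y - p = 0"
    by (rule invariant_sum_zero_imp_zero[OF G irr])
      (use y p in \<open>auto simp: vector_matrix_mult_diff_distrib sum_subtractf\<close>)
  then show "y = p" by simp
qed (use p in auto)

lemma
  fixes G :: "real ^ 'n ^ 'n"
  assumes G: "stochastic G" and irr: "irreducible_matrix G"
  shows invariant_distribution_invariant:
      "invariant_distribution G v* G = invariant_distribution G"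
    and invariant_distribution_sum: "(\<Sum>k\<in>UNIV. invariant_distribution G $ k) = 1"
    and invariant_distribution_pos: "invariant_distribution G $ k > 0"
proof -
  obtain x where "x \<noteq> 0" and x: "x v* G = x"
    using stochastic_has_invariant_vector[OF G] by blast
  then obtain a where a: "x $ a \<noteq> 0" by (auto simp: vec_eq_iff)
  let ?s = "\<Sum>k\<in>UNIV. \<bar>x $ k\<bar>"
  have pos: "\<bar>x $ k\<bar> > 0" for k
    using invariant_nonneg_imp_pos[OF G irr invariant_abs[OF G x], of a k] a by simp
  then have s: "?s > 0" by (intro sum_pos) auto
  define p where "p = (\<chi> k. \<bar>x $ k\<bar> / ?s)"
  have p: "p v* G = p"
    using invariant_abs[OF G x]
    by (simp add: invariant_iff p_def sum_divide_distrib[symmetric])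
  have p1: "(\<Sum>k\<in>UNIV. p $ k) = 1"
    using s by (simp add: p_def sum_divide_distrib[symmetric])
  have eq: "invariant_distribution G = p"
    by (rule invariant_distribution_eqI[OF G irr p p1])
  show "invariant_distribution G v* G = invariant_distribution G"
    and "(\<Sum>k\<in>UNIV. invariant_distribution G $ k) = 1"
    and "invariant_distribution G $ k > 0"
    using p p1 pos[of k] s by (simp_all add: eq p_def)
qed

section \<open>The effect of moving mass within one row\<close>

text \<open>The Dirichlet problem with boundary values one at \<open>a\<close> and zero at \<open>b\<close>. A solution is a fixed point of
  one averaging step, which preserves the unit cube, so Brouwer's theorem applies. If \<open>P\<close> is
  irreducible, \<open>r k\<close> is the probability of reaching \<open>a\<close> before \<open>b\<close> from \<open>k\<close>.\<close>

lemma harmonic_function_exists: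
  fixes P :: "'a::finite \<Rightarrow> 'a \<Rightarrow> real"
  assumes nonneg: "\<And>k l. 0 \<le> P k l" and sum1: "\<And>k. (\<Sum>l\<in>UNIV. P k l) = 1" and "a \<noteq> b"
  obtains r where "\<And>k. 0 \<le> r k" and "\<And>k. r k \<le> 1" and "r a = 1" and "r b = 0"
    and "\<And>k. k \<noteq> a \<Longrightarrow> k \<noteq> b \<Longrightarrow> r k = (\<Sum>l\<in>UNIV. P k l * r l)"
proof -
  define f :: "real ^ 'a \<Rightarrow> real ^ 'a" where
    "f r = (\<chi> k. if k = a then 1 else if k = b then 0 else \<Sum>l\<in>UNIV. P k l * r $ l)" for r
  have "\<exists>r\<in>cbox 0 1. f r = r"
  proof (rule brouwer)
    show "continuous_on (cbox 0 1) f"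
      unfolding f_def
    proof (rule continuous_on_vec_lambda)
      fix k
      show "continuous_on (cbox 0 1)
          (\<lambda>r. if k = a then 1 else if k = b then 0 else \<Sum>l\<in>UNIV. P k l * r $ l)"
        by (cases "k = a"; cases "k = b") (auto intro!: continuous_intros)
    qed
    show "f \<in> cbox 0 1 \<rightarrow> cbox 0 1"
    proof
      fix r :: "real ^ 'a" assume "r \<in> cbox 0 1"
      then have r: "0 \<le> r $ l" "r $ l \<le> 1" for l by (auto simp: mem_box_cart)
      have "(\<Sum>l\<in>UNIV. P k l * r $ l) \<le> 1" for k
        using sum_mono[of UNIV "\<lambda>l. P k l * r $ l" "\<lambda>l. P k l"] mult_left_le[OF r(2) nonneg]
        by (simp add: sum1)
      then show "f r \<in> cbox 0 1"
        by (auto simp: mem_box_cart f_def intro!: sum_nonneg mult_nonneg_nonneg nonneg r)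
    qed
    show "cbox 0 (1 :: real ^ 'a) \<noteq> {}"
      by (auto simp: interval_ne_empty_cart)
  qed auto
  then obtain r where r: "r \<in> cbox 0 1" "f r = r" by blast
  show thesis
  proof (rule that[of "\<lambda>k. r $ k"])
    show "0 \<le> r $ k" "r $ k \<le> 1" for k using r(1) by (auto simp: mem_box_cart)
    have rk: "r $ k = f r $ k" for k by (simp add: r(2))
    show "r $ a = 1" "r $ b = 0"
      and "\<And>k. k \<noteq> a \<Longrightarrow> k \<noteq> b \<Longrightarrow> r $ k = (\<Sum>l\<in>UNIV. P k l * r $ l)"
      using \<open>a \<noteq> b\<close> by (subst rk, simp add: f_def)+
  qed
qed

text \<open>Take for \<open>r\<close> the solution of the Dirichlet problem of the time-reversed chain. Let \<open>u\<^sub>k = p\<^sub>k r k\<close> and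
  let \<open>f = u - u G\<close> be its defect. Harmonicity of \<open>r\<close> says exactly that \<open>f\<close> is supported on \<open>{i, j}\<close>. The
  two values of \<open>f\<close> follow by pairing \<open>f\<close> with the constant function, which gives \<open>f i + f j = 0\<close>, and
  with \<open>q\<close>, which is harmonic for \<open>G\<close> and gives \<open>f j = - p\<^sub>i Q\<close>.\<close>

lemma flux_between_states:
  fixes G :: "real ^ 'n ^ 'n"
  assumes G: "stochastic G" and p: "p v* G = p" and pos: "\<And>k. p $ k > 0" and "i \<noteq> j"
    and q: "q i = 0" "q j = 1"
      "\<And>k. k \<noteq> i \<Longrightarrow> k \<noteq> j \<Longrightarrow> q k = (\<Sum>l\<in>UNIV. G $ k $ l * q l)"
  obtains r where "\<And>k. 0 \<le> r k" and "\<And>k. r k \<le> 1" and "r i = 1"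
    and "\<And>l. (\<Sum>k\<in>UNIV. p $ k * r k * G $ k $ l) =
      p $ l * r l - p $ i * (\<Sum>k\<in>UNIV. G $ i $ k * q k) * (of_bool (l = i) - of_bool (l = j))"
proof -
  \<comment> \<open>The transition probabilities of the time-reversed chain.\<close>
  define P where "P l k = p $ k * G $ k $ l / p $ l" for l k
  have "0 \<le> P l k" for l k
    using pos[of k] pos[of l] stochastic_nonneg[OF G, of k l] by (simp add: P_def)
  moreover have "(\<Sum>k\<in>UNIV. P l k) = 1" for l
    using p pos[of l] by (simp add: P_def sum_divide_distrib[symmetric] invariant_iff)
  ultimately obtain r where r: "\<And>k. 0 \<le> r k" "\<And>k. r k \<le> 1" "r i = 1" "r j = 0"
    and harm: "\<And>l. l \<noteq> i \<Longrightarrow> l \<noteq> j \<Longrightarrow> r l = (\<Sum>k\<in>UNIV. P l k * r k)"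
    using harmonic_function_exists[of P i j] \<open>i \<noteq> j\<close> by blast
  let ?Q = "\<Sum>k\<in>UNIV. G $ i $ k * q k"
  define f where "f l = p $ l * r l - (\<Sum>k\<in>UNIV. p $ k * r k * G $ k $ l)" for l
  have f0: "f l = 0" if "l \<noteq> i" "l \<noteq> j" for l
  proof -
    have "p $ l * r l = (\<Sum>k\<in>UNIV. p $ l * (P l k * r k))"
      using harm[OF that] by (simp add: sum_distrib_left)
    also have "\<dots> = (\<Sum>k\<in>UNIV. p $ k * r k * G $ k $ l)"
      using pos[of l] by (intro sum.cong) (simp_all add: P_def)
    finally show ?thesis by (simp add: f_def)
  qed
  have supp: "(\<Sum>l\<in>UNIV. f l * g l) = f i * g i + f j * g j" for g
  proof -
    have "(\<Sum>l\<in>UNIV. f l * g l) = (\<Sum>l\<in>{i, j}. f l * g l)"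
      by (rule sum.mono_neutral_right) (auto simp: f0)
    then show ?thesis using \<open>i \<noteq> j\<close> by simp
  qed
  \<comment> \<open>Summation by parts moves \<open>I - G\<close> from \<open>u\<close> to the test function.\<close>
  have pairing: "(\<Sum>l\<in>UNIV. f l * g l) =
      (\<Sum>k\<in>UNIV. p $ k * r k * (g k - (\<Sum>l\<in>UNIV. G $ k $ l * g l)))" for g
  proof -
    have "(\<Sum>l\<in>UNIV. f l * g l) = (\<Sum>l\<in>UNIV. p $ l * r l * g l)
        - (\<Sum>l\<in>UNIV. \<Sum>k\<in>UNIV. p $ k * r k * G $ k $ l * g l)"
      by (simp add: f_def left_diff_distrib sum_subtractf sum_distrib_right)
    also have "(\<Sum>l\<in>UNIV. \<Sum>k\<in>UNIV. p $ k * r k * G $ k $ l * g l) =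
        (\<Sum>k\<in>UNIV. p $ k * r k * (\<Sum>l\<in>UNIV. G $ k $ l * g l))"
      by (subst sum.swap) (simp add: sum_distrib_left mult.assoc)
    finally show ?thesis by (simp add: right_diff_distrib sum_subtractf)
  qed
  have "f i + f j = 0"
    using supp[of "\<lambda>_. 1"] pairing[of "\<lambda>_. 1"] by (simp add: stochastic_row_sum[OF G])
  moreover have "f j = - (p $ i * ?Q)"
  proof -
    have "f j = (\<Sum>k\<in>UNIV. p $ k * r k * (q k - (\<Sum>l\<in>UNIV. G $ k $ l * q l)))"
      using supp[of q] pairing[of q] q by simp
    also have "\<dots> = (\<Sum>k\<in>{i}. p $ k * r k * (q k - (\<Sum>l\<in>UNIV. G $ k $ l * q l)))"
      by (rule sum.mono_neutral_right) (use r q(3) in force)+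
    finally show ?thesis using r q by simp
  qed
  ultimately have "f l = p $ i * ?Q * (of_bool (l = i) - of_bool (l = j))" for l
    using f0[of l] \<open>i \<noteq> j\<close> by (cases "l = i"; cases "l = j") auto
  then show thesis
    using that[of r] r by (simp add: f_def algebra_simps)
qed

definition move_mass :: "'n \<Rightarrow> 'n \<Rightarrow> real \<Rightarrow> real ^ 'n ^ 'n \<Rightarrow> real ^ 'n ^ 'n" where
  "move_mass i j d G =
     (\<chi> k l. G $ k $ l + of_bool (k = i) * d * (of_bool (l = j) - of_bool (l = i)))"

text \<open>The denominator is the probability that \<open>G\<close> started at \<open>i\<close> reaches \<open>j\<close> before returning to \<open>i\<close>, written
  as the average over the first step of a function \<open>q\<close> that is harmonic away from \<open>i\<close> and \<open>j\<close>.\<close>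

lemma ln_invariant_distribution_move_mass:
  fixes G :: "real ^ 'n ^ 'n"
  assumes G: "stochastic G" "irreducible_matrix G"
    and H: "stochastic (move_mass i j d G)" "irreducible_matrix (move_mass i j d G)"
    and "i \<noteq> j" "0 \<le> d"
    and q: "q i = 0" "q j = 1"
      "\<And>k. k \<noteq> i \<Longrightarrow> k \<noteq> j \<Longrightarrow> q k = (\<Sum>l\<in>UNIV. G $ k $ l * q l)"
    and Q: "(\<Sum>k\<in>UNIV. G $ i $ k * q k) > 0"
  shows "\<bar>ln (invariant_distribution (move_mass i j d G) $ m) - ln (invariant_distribution G $ m)\<bar>
    \<le> d / (\<Sum>k\<in>UNIV. G $ i $ k * q k)"
proof -
  define p where "p = invariant_distribution G"
  define Q where "Q = (\<Sum>k\<in>UNIV. G $ i $ k * q k)"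
  define e where "e = d / Q"
  have Q0: "Q > 0" and e0: "e \<ge> 0" and eQ: "e * Q = d"
    using assms by (auto simp: Q_def e_def)
  have p: "p v* G = p" and p1: "(\<Sum>k\<in>UNIV. p $ k) = 1" and pos: "p $ k > 0" for k
    using invariant_distribution_invariant[OF G] invariant_distribution_sum[OF G]
      invariant_distribution_pos[OF G] by (auto simp: p_def)
  obtain r where r: "\<And>k. 0 \<le> r k" "\<And>k. r k \<le> 1" "r i = 1"
    and flux: "\<And>l. (\<Sum>k\<in>UNIV. p $ k * r k * G $ k $ l) =
      p $ l * r l - p $ i * Q * (of_bool (l = i) - of_bool (l = j))"
    using flux_between_states[OF G(1) p pos \<open>i \<noteq> j\<close> q] unfolding Q_def by blast
  \<comment> \<open>The new invariant distribution up to its total mass \<open>s\<close>. The strength of the flux out of \<open>i\<close> is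
    \<open>p $ i * Q\<close>, and \<open>w $ i = p $ i\<close> because \<open>r i = 1\<close>, so the choice \<open>e = d / Q\<close> cancels the defect that
    the move of mass \<open>d\<close> produces.\<close>
  define w where "w = (\<chi> k. p $ k * (1 + e * (1 - r k)))"
  define s where "s = 1 + e * (1 - (\<Sum>k\<in>UNIV. p $ k * r k))"
  have "(\<Sum>k\<in>UNIV. p $ k * r k) \<le> (\<Sum>k\<in>UNIV. p $ k)"
    by (intro sum_mono mult_left_le r less_imp_le[OF pos])
  moreover have "0 \<le> (\<Sum>k\<in>UNIV. p $ k * r k)"
    by (intro sum_nonneg mult_nonneg_nonneg r less_imp_le[OF pos])
  ultimately have s: "1 \<le> s" "s \<le> 1 + e"
    using e0 p1 by (auto simp: s_def mult_left_le)
  have w_sum: "(\<Sum>k\<in>UNIV. w $ k) = s"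
    using p1 by (simp add: w_def s_def algebra_simps sum.distrib sum_subtractf
        sum_distrib_left[symmetric])
  have "(\<Sum>k\<in>UNIV. w $ k * move_mass i j d G $ k $ l) = w $ l" for l
  proof -
    have "(\<Sum>k\<in>UNIV. w $ k * move_mass i j d G $ k $ l) =
        (\<Sum>k\<in>UNIV. w $ k * G $ k $ l)
        + (\<Sum>k\<in>UNIV. of_bool (k = i) * (w $ k * d * (of_bool (l = j) - of_bool (l = i))))"
      by (simp add: move_mass_def distrib_left sum.distrib mult_ac)
    also have "(\<Sum>k\<in>UNIV. w $ k * G $ k $ l) =
        (1 + e) * (\<Sum>k\<in>UNIV. p $ k * G $ k $ l) - e * (\<Sum>k\<in>UNIV. p $ k * r k * G $ k $ l)"
      by (simp add: w_def sum_distrib_left sum_subtractf[symmetric] algebra_simps)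
    also have "\<dots> = w $ l + e * Q * p $ i * (of_bool (l = i) - of_bool (l = j))"
      using p unfolding flux by (simp add: invariant_iff w_def algebra_simps)
    also have "(\<Sum>k\<in>UNIV. of_bool (k = i) * (w $ k * d * (of_bool (l = j) - of_bool (l = i)))) =
        p $ i * d * (of_bool (l = j) - of_bool (l = i))"
      by (simp add: of_bool_def if_distrib[where f = "\<lambda>x. x * _"] w_def r cong: if_cong)
    also have "w $ l + e * Q * p $ i * (of_bool (l = i) - of_bool (l = j))
        + p $ i * d * (of_bool (l = j) - of_bool (l = i)) = w $ l"
      unfolding eQ by (simp add: algebra_simps)
    finally show ?thesis .
  qed
  then have "invariant_distribution (move_mass i j d G) = (\<chi> k. w $ k / s)"
    using w_sum s
    by (intro invariant_distribution_eqI[OF H])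
      (simp_all add: invariant_iff sum_divide_distrib[symmetric])
  then have "invariant_distribution (move_mass i j d G) $ m = p $ m * (1 + e * (1 - r m)) / s"
    by (simp add: w_def)
  moreover have t: "1 \<le> 1 + e * (1 - r m)" "1 + e * (1 - r m) \<le> 1 + e"
    using r(1,2)[of m] e0 by (auto simp: mult_left_le)
  ultimately have "ln (invariant_distribution (move_mass i j d G) $ m) - ln (p $ m) =
      ln (1 + e * (1 - r m)) - ln s"
    using s pos[of m] by (simp add: ln_div ln_mult)
  moreover have "0 \<le> ln x" "ln x \<le> e" if "1 \<le> x" "x \<le> 1 + e" for x
  proof -
    show "0 \<le> ln x" using that by simp
    have "ln x \<le> ln (1 + e)" using that by simp
    also have "\<dots> \<le> e" by (rule ln_add_one_self_le_self[OF e0])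
    finally show "ln x \<le> e" .
  qed
  note this[OF t] this[OF s]
  ultimately show ?thesis
    unfolding p_def[symmetric] Q_def[symmetric] e_def[symmetric] by linarith
qed

section \<open>First passage probabilities of finite Markov chains\<close>

lemma sets_markov_law: "sets (markov_law P i) = sets (\<Pi>\<^sub>M n\<in>UNIV. count_space UNIV)"
  by (simp add: markov_law_def)

lemma cylinder_in_sets_markov_law:
  fixes x :: "nat \<Rightarrow> 's::countable"
  shows "{X. \<forall>t\<le>n. X t = x t} \<in> sets (markov_law P i)"
proof -
  have "{X \<in> space (\<Pi>\<^sub>M n\<in>UNIV. count_space (UNIV :: 's set)). \<forall>t\<in>{..n}. X t = x t}
      \<in> sets (\<Pi>\<^sub>M n\<in>UNIV. count_space UNIV)"
    by measurable
  then show ?thesis by (simp add: sets_markov_law space_PiM atMost_def)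
qed

text \<open>A property of the states up to time \<open>n\<close> is a finite disjoint union of cylinders, indexed by the
  functions that are undefined beyond \<open>n\<close>. This reduces every probability below to
  \<open>markov_law_cylinder\<close>.\<close>

lemma history_eq_Union_cylinders:
  fixes R :: "(nat \<Rightarrow> 's::finite) \<Rightarrow> bool"
  assumes R: "\<And>X Y. (\<And>t. t \<le> n \<Longrightarrow> X t = Y t) \<Longrightarrow> R X = R Y"
  shows "{X. R X} = (\<Union>x\<in>{x \<in> {..n} \<rightarrow>\<^sub>E UNIV. R x}. {X. \<forall>t\<le>n. X t = x t})"
proof (rule set_eqI)
  fix X :: "nat \<Rightarrow> 's"
  show "X \<in> {X. R X} \<longleftrightarrow> X \<in> (\<Union>x\<in>{x \<in> {..n} \<rightarrow>\<^sub>E UNIV. R x}. {X. \<forall>t\<le>n. X t = x t})"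
  proof
    assume X: "X \<in> {X. R X}"
    have "R (restrict X {..n}) = R X" by (rule R) simp
    with X show "X \<in> (\<Union>x\<in>{x \<in> {..n} \<rightarrow>\<^sub>E UNIV. R x}. {X. \<forall>t\<le>n. X t = x t})"
      by (intro UN_I[of "restrict X {..n}"]) auto
  next
    assume "X \<in> (\<Union>x\<in>{x \<in> {..n} \<rightarrow>\<^sub>E UNIV. R x}. {X. \<forall>t\<le>n. X t = x t})"
    then obtain x where "R x" "\<And>t. t \<le> n \<Longrightarrow> X t = x t" by auto
    then show "X \<in> {X. R X}" using R[of X x] by auto
  qed
qed

lemma finite_histories: "finite {x \<in> {..n::nat} \<rightarrow>\<^sub>E (UNIV :: 's::finite set). R x}"
  by (rule finite_subset[of _ "{..n} \<rightarrow>\<^sub>E UNIV"]) (auto intro: finite_PiE)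

lemma history_in_sets_markov_law:
  fixes R :: "(nat \<Rightarrow> 's::finite) \<Rightarrow> bool"
  assumes "\<And>X Y. (\<And>t. t \<le> n \<Longrightarrow> X t = Y t) \<Longrightarrow> R X = R Y"
  shows "{X. R X} \<in> sets (markov_law P i)"
  by (subst history_eq_Union_cylinders[OF assms])
    (auto intro!: sets.finite_UN finite_histories cylinder_in_sets_markov_law)

lemma markov_property:
  fixes P :: "'s::finite \<Rightarrow> 's \<Rightarrow> real"
  assumes nonneg: "\<And>k l. 0 \<le> P k l" and sum1: "\<And>k. (\<Sum>l\<in>UNIV. P k l) = 1"
    and R: "\<And>X Y. (\<And>t. t \<le> n \<Longrightarrow> X t = Y t) \<Longrightarrow> R X = R Y"
  shows "measure (markov_law P i) {X. R X \<and> X n = k \<and> X (Suc n) = l} =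
    measure (markov_law P i) {X. R X \<and> X n = k} * P k l"
proof -
  interpret prob_space "markov_law P i" by (rule prob_space_markov_law)
  let ?T = "{x \<in> {..n} \<rightarrow>\<^sub>E UNIV. R x \<and> x n = k}"
  let ?C = "\<lambda>m x. {X. \<forall>t\<le>m. X t = x t}"
  have now: "{X. R X \<and> X n = k} = (\<Union>x\<in>?T. ?C n x)"
    by (rule history_eq_Union_cylinders) (metis R order_refl)
  have "{X. R X \<and> X n = k \<and> X (Suc n) = l} = {X. R X \<and> X n = k} \<inter> {X. X (Suc n) = l}"
    by auto
  also have "\<dots> = (\<Union>x\<in>?T. ?C (Suc n) (x(Suc n := l)))"
    unfolding now by (fastforce simp: le_Suc_eq)
  finally have later: "{X. R X \<and> X n = k \<and> X (Suc n) = l} = \<dots>" .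
  have disj: "disjoint_family_on (?C n) ?T"
  unfolding disjoint_family_on_def
  proof (intro ballI impI)
    fix x y assume xy: "x \<in> ?T" "y \<in> ?T" "x \<noteq> y"
    then have "\<exists>t\<le>n. x t \<noteq> y t"
      by (metis (mono_tags, lifting) CollectD PiE_ext atMost_iff)
    then show "?C n x \<inter> ?C n y = {}" by auto
  qed
  have disj': "disjoint_family_on (\<lambda>x. ?C (Suc n) (x(Suc n := l))) ?T"
  proof -
    have "?C (Suc n) (x(Suc n := l)) \<subseteq> ?C n x" for x by auto
    with disj show ?thesis unfolding disjoint_family_on_def by blast
  qed
  have "prob {X. R X \<and> X n = k \<and> X (Suc n) = l} =
      (\<Sum>x\<in>?T. prob (?C (Suc n) (x(Suc n := l))))"
    unfolding later
    by (rule finite_measure_finite_Union[OF finite_histories _ disj'])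
      (intro image_subsetI cylinder_in_sets_markov_law)
  also have "\<dots> = (\<Sum>x\<in>?T. prob (?C n x) * P k l)"
  proof (rule sum.cong[OF refl])
    fix x assume "x \<in> ?T"
    then show "prob (?C (Suc n) (x(Suc n := l))) = prob (?C n x) * P k l"
      by (simp add: markov_law_cylinder[of P, OF nonneg sum1] cong: prod.cong_simp)
  qed
  also have "\<dots> = prob {X. R X \<and> X n = k} * P k l"
    unfolding now sum_distrib_right[symmetric]
    by (subst finite_measure_finite_Union[OF finite_histories _ disj])
      (auto intro: cylinder_in_sets_markov_law)
  finally show ?thesis .
qed

text \<open>Time zero is exempt, as for return times: the chain may start in \<open>D\<close>.\<close>

definition avoids :: "'s set \<Rightarrow> nat \<Rightarrow> (nat \<Rightarrow> 's) \<Rightarrow> bool" where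
  "avoids D n X \<longleftrightarrow> (\<forall>t. 0 < t \<and> t \<le> n \<longrightarrow> X t \<notin> D)"

text \<open>For \<open>j \<in> D\<close> this is the event that the first visit to \<open>D\<close> after time zero happens at time \<open>Suc n\<close>,
  and at \<open>j\<close>. For \<open>j \<notin> D\<close> it is the event that \<open>D\<close> is avoided up to time \<open>Suc n\<close> and the chain is then
  at \<open>j\<close>, which gives the recursion for \<open>taboo_prob\<close>.\<close>

definition first_passage :: "'s set \<Rightarrow> 's \<Rightarrow> nat \<Rightarrow> (nat \<Rightarrow> 's) set" where
  "first_passage D j n = {X. avoids D n X \<and> X (Suc n) = j}"

definition taboo_prob :: "('s \<Rightarrow> 's \<Rightarrow> real) \<Rightarrow> 's \<Rightarrow> 's set \<Rightarrow> nat \<Rightarrow> 's \<Rightarrow> real" where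
  "taboo_prob P i D n k = measure (markov_law P i) {X. avoids D n X \<and> X n = k}"

lemma avoids_cong: "(\<And>t. t \<le> n \<Longrightarrow> X t = Y t) \<Longrightarrow> avoids D n X = avoids D n Y"
  by (simp add: avoids_def)

lemma avoids_Suc: "avoids D (Suc n) X \<longleftrightarrow> avoids D n X \<and> X (Suc n) \<notin> D"
  by (auto simp: avoids_def le_Suc_eq)

lemma taboo_prob_nonneg: "0 \<le> taboo_prob P i D n k"
  by (simp add: taboo_prob_def)

lemma taboo_prob_0:
  fixes P :: "'s::finite \<Rightarrow> 's \<Rightarrow> real"
  assumes nonneg: "\<And>k l. 0 \<le> P k l" and sum1: "\<And>k. (\<Sum>l\<in>UNIV. P k l) = 1"
  shows "taboo_prob P i D 0 k = of_bool (k = i)"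
  using markov_law_cylinder[where P = P and n = 0 and x = "\<lambda>_. k" and i = i, OF nonneg sum1]
  by (auto simp: taboo_prob_def avoids_def)

lemma first_passage_in_sets:
  fixes P :: "'s::finite \<Rightarrow> 's \<Rightarrow> real"
  shows "first_passage D j n \<in> sets (markov_law P i)"
  unfolding first_passage_def
  by (rule history_in_sets_markov_law[where n = "Suc n"])
    (metis avoids_cong le_SucI order_refl)

lemma prob_first_passage:
  fixes P :: "'s::finite \<Rightarrow> 's \<Rightarrow> real"
  assumes nonneg: "\<And>k l. 0 \<le> P k l" and sum1: "\<And>k. (\<Sum>l\<in>UNIV. P k l) = 1"
  shows "measure (markov_law P i) (first_passage D j n) = (\<Sum>k\<in>UNIV. taboo_prob P i D n k * P k j)"
proof -
  interpret prob_space "markov_law P i" by (rule prob_space_markov_law)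
  let ?E = "\<lambda>k. {X. avoids D n X \<and> X n = k \<and> X (Suc n) = j}"
  have "?E k \<in> events" for k
    by (rule history_in_sets_markov_law[where n = "Suc n"])
      (metis avoids_cong le_SucI order_refl)
  moreover have "first_passage D j n = (\<Union>k. ?E k)"
    by (auto simp: first_passage_def)
  ultimately have "prob (first_passage D j n) = (\<Sum>k\<in>UNIV. prob (?E k))"
    by (simp only:) (rule finite_measure_finite_Union, auto simp: disjoint_family_on_def)
  then show ?thesis
    unfolding taboo_prob_def
    by (simp add: markov_property[of P n "avoids D n", OF nonneg sum1 avoids_cong])
qed

lemma taboo_prob_Suc:
  fixes P :: "'s::finite \<Rightarrow> 's \<Rightarrow> real"
  assumes nonneg: "\<And>k l. 0 \<le> P k l" and sum1: "\<And>k. (\<Sum>l\<in>UNIV. P k l) = 1"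
  shows "taboo_prob P i D (Suc n) l =
    (if l \<in> D then 0 else \<Sum>k\<in>UNIV. taboo_prob P i D n k * P k l)"
proof (cases "l \<in> D")
  case True
  then have "{X. avoids D (Suc n) X \<and> X (Suc n) = l} = {}" by (auto simp: avoids_Suc)
  then show ?thesis using True by (simp only: taboo_prob_def) simp
next
  case False
  then have "{X. avoids D (Suc n) X \<and> X (Suc n) = l} = first_passage D l n"
    by (auto simp: avoids_Suc first_passage_def)
  then show ?thesis
    using False prob_first_passage[of P, OF nonneg sum1] by (simp only: taboo_prob_def) simp
qed

text \<open>The process \<open>q (X n)\<close>, stopped at its first visit to \<open>D\<close> after time zero, is a supermartingale from
  time one on, and its expectation at time one is the right-hand side. In terms of the quantities below,
  \<open>V n\<close> is the expectation of \<open>q (X (Suc n))\<close> on the event that \<open>D\<close> has been avoided up to time \<open>n\<close>. One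
  step turns at least the probability of a first passage to \<open>j\<close> into a loss of \<open>V\<close>.\<close>

lemma prob_first_passage_le:
  fixes P :: "'s::finite \<Rightarrow> 's \<Rightarrow> real"
  assumes nonneg: "\<And>k l. 0 \<le> P k l" and sum1: "\<And>k. (\<Sum>l\<in>UNIV. P k l) = 1"
    and "j \<in> D" and q: "\<And>k. 0 \<le> q k" "q j = 1"
    and super: "\<And>k. k \<notin> D \<Longrightarrow> (\<Sum>l\<in>UNIV. P k l * q l) \<le> q k"
  shows "measure (markov_law P i) (\<Union>n. first_passage D j n) \<le> (\<Sum>l\<in>UNIV. P i l * q l)"
proof -
  interpret prob_space "markov_law P i" by (rule prob_space_markov_law)
  let ?b = "\<lambda>n. prob (first_passage D j n)"
  let ?a = "taboo_prob P i D"
  define V where "V n = (\<Sum>k\<in>UNIV. ?a n k * (\<Sum>l\<in>UNIV. P k l * q l))" for n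
  have V0: "V n \<ge> 0" for n
    unfolding V_def by (intro sum_nonneg mult_nonneg_nonneg taboo_prob_nonneg nonneg q)
  have step: "?b n + V (Suc n) \<le> V n" for n
  proof -
    let ?w = "\<lambda>l. \<Sum>k\<in>UNIV. ?a n k * P k l"
    have w0: "0 \<le> ?w l" for l
      by (intro sum_nonneg mult_nonneg_nonneg taboo_prob_nonneg nonneg)
    have "V (Suc n) = (\<Sum>l\<in>-D. ?w l * (\<Sum>l'\<in>UNIV. P l l' * q l'))"
      unfolding V_def taboo_prob_Suc[of P, OF nonneg sum1]
      by (rule sum.mono_neutral_cong_right) auto
    also have "\<dots> \<le> (\<Sum>l\<in>-D. ?w l * q l)"
      by (intro sum_mono mult_left_mono super w0) auto
    finally have "?b n + V (Suc n) \<le> ?w j * q j + (\<Sum>l\<in>-D. ?w l * q l)"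
      using q by (simp add: prob_first_passage[of P, OF nonneg sum1])
    also have "\<dots> = (\<Sum>l\<in>insert j (-D). ?w l * q l)"
      using \<open>j \<in> D\<close> by simp
    also have "\<dots> \<le> (\<Sum>l\<in>UNIV. ?w l * q l)"
      by (rule sum_mono2) (auto intro!: mult_nonneg_nonneg w0 q)
    also have "\<dots> = V n"
      unfolding V_def sum_distrib_right sum_distrib_left
      by (subst sum.swap) (simp add: mult.assoc)
    finally show ?thesis .
  qed
  have "(\<Sum>n<N. ?b n) + V N \<le> V 0" for N
  proof (induction N)
    case (Suc N)
    then show ?case using step[of N] by simp
  qed simp
  then have bound: "(\<Sum>n<N. ?b n) \<le> V 0" for N
    using V0[of N] by (smt (verit))
  have summable: "summable ?b"
    by (rule summableI_nonneg_bounded[OF _ bound]) simp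
  have "prob (\<Union>n. first_passage D j n) \<le> (\<Sum>n. ?b n)"
    by (rule finite_measure_subadditive_countably)
      (auto simp: first_passage_in_sets summable)
  also have "\<dots> \<le> V 0"
    by (rule suminf_le_const[OF summable bound])
  also have "V 0 = (\<Sum>l\<in>UNIV. P i l * q l)"
    by (simp add: V_def taboo_prob_0[of P, OF nonneg sum1] of_bool_def
        if_distrib[where f = "\<lambda>x. x * _"] cong: if_cong)
  finally show ?thesis .
qed

text \<open>If all first passages to \<open>j\<close> were null events, a path from \<open>i\<close> could never step to \<open>j\<close>: each of its
  states is occupied with positive probability at some time while \<open>D\<close> is avoided. This holds even when
  the path comes back to \<open>i \<in> D\<close>, because \<open>i\<close> is occupied at time zero. Paths therefore need not be
  made simple first.\<close>

lemma prob_first_passage_pos: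
  fixes P :: "'s::finite \<Rightarrow> 's \<Rightarrow> real"
  assumes nonneg: "\<And>k l. 0 \<le> P k l" and sum1: "\<And>k. (\<Sum>l\<in>UNIV. P k l) = 1"
    and path: "(i, j) \<in> {(k, l). P k l > 0 \<and> (l \<in> D \<longrightarrow> l = i \<or> l = j)}\<^sup>*" and "i \<noteq> j"
  shows "measure (markov_law P i) (\<Union>n. first_passage D j n) > 0"
proof (rule ccontr)
  interpret prob_space "markov_law P i" by (rule prob_space_markov_law)
  let ?a = "taboo_prob P i D"
  assume "\<not> ?thesis"
  then have zero: "prob (\<Union>n. first_passage D j n) = 0" by (simp add: zero_less_measure_iff)
  have b: "prob (first_passage D j n) = 0" for n
  proof -
    have "prob (first_passage D j n) \<le> prob (\<Union>n. first_passage D j n)"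
      by (rule finite_measure_mono) (auto intro!: sets.countable_UN simp: first_passage_in_sets)
    then show ?thesis using zero by (simp add: measure_le_0_iff)
  qed
  have mass: "0 < (\<Sum>y\<in>UNIV. ?a n y * P y l)" if "0 < ?a n k" "0 < P k l" for n k l
  proof -
    have "0 < ?a n k * P k l" using that by simp
    also have "\<dots> \<le> (\<Sum>y\<in>UNIV. ?a n y * P y l)"
      by (rule member_le_sum) (auto simp: nonneg taboo_prob_nonneg)
    finally show ?thesis .
  qed
  have "x \<noteq> j \<and> (\<exists>n. 0 < ?a n x)"
    if "(i, x) \<in> {(k, l). P k l > 0 \<and> (l \<in> D \<longrightarrow> l = i \<or> l = j)}\<^sup>*" for x
    using that
  proof (induction rule: rtrancl_induct)
    case base
    have "0 < ?a 0 i" by (simp add: taboo_prob_0[of P, OF nonneg sum1])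
    with \<open>i \<noteq> j\<close> show ?case by blast
  next
    case (step k l)
    then obtain n where n: "0 < ?a n k" "0 < P k l" by auto
    have "l \<noteq> j"
      using mass[OF n] b[of n] by (auto simp: prob_first_passage[of P, OF nonneg sum1])
    moreover have "0 < ?a 0 i" by (simp add: taboo_prob_0[of P, OF nonneg sum1])
    moreover have "0 < ?a (Suc n) l" if "l \<notin> D"
      using mass[OF n] that by (simp add: taboo_prob_Suc[of P, OF nonneg sum1])
    ultimately show ?case using step.hyps by blast
  qed
  from this[OF path] show False by simp
qed

section \<open>Comparison of the escape probabilities\<close>

lemma enat_less_return_time_iff:
  "enat s < return_time k X \<longleftrightarrow> (\<forall>t. 0 < t \<and> t \<le> s \<longrightarrow> X t \<noteq> k)"
proof -
  have "return_time k X \<le> enat s \<longleftrightarrow> return_time k X < enat (Suc s)"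
    by (cases "return_time k X") auto
  also have "\<dots> \<longleftrightarrow> (\<exists>t. 0 < t \<and> t \<le> s \<and> X t = k)"
    unfolding return_time_def INF_less_iff by (simp add: less_Suc_eq_le) blast
  finally show ?thesis unfolding not_le[symmetric] by blast
qed

lemma return_time_less_iff:
  "return_time k X < x \<longleftrightarrow> (\<exists>s. 0 < s \<and> X s = k \<and> enat s < x)"
  unfolding return_time_def INF_less_iff by blast

lemma return_before_eq_first_passage:
  fixes i j w :: 's
  assumes "i \<noteq> j" "w \<noteq> j"
  shows "{X. return_time j X < min (return_time i X) (return_time w X)} =
    (\<Union>n. first_passage {i, j, w} j n)"
proof (rule set_eqI)
  fix X :: "nat \<Rightarrow> 's"
  let ?ok = "\<lambda>s. 0 < s \<and> X s = j \<and> (\<forall>t. 0 < t \<and> t \<le> s \<longrightarrow> X t \<noteq> i \<and> X t \<noteq> w)"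
  have "X \<in> {X. return_time j X < min (return_time i X) (return_time w X)} \<longleftrightarrow> (\<exists>s. ?ok s)"
    unfolding mem_Collect_eq
    by (subst return_time_less_iff, unfold min_less_iff_conj enat_less_return_time_iff, rule iff_exI)
      blast
  also have "\<dots> \<longleftrightarrow> X \<in> (\<Union>n. first_passage {i, j, w} j n)"
  proof
    assume "\<exists>s. ?ok s"
    then obtain u where u: "0 < u" "X u = j"
      and others: "\<And>t. 0 < t \<Longrightarrow> t \<le> u \<Longrightarrow> X t \<noteq> i \<and> X t \<noteq> w" by blast
    \<comment> \<open>Before its first visit to \<open>j\<close> the path avoids \<open>j\<close>, and up to the time \<open>u \<ge> s\<close> it avoids \<open>i\<close> and \<open>w\<close>.\<close>
    define s where "s = (LEAST s. 0 < s \<and> X s = j)"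
    have s: "0 < s \<and> X s = j"
      unfolding s_def by (rule LeastI[of _ u]) (use u in simp)
    have "s \<le> u"
      unfolding s_def by (rule Least_le) (use u in simp)
    have least: "X t \<noteq> j" if "0 < t" "t < s" for t
      using not_less_Least[of t "\<lambda>s. 0 < s \<and> X s = j"] that unfolding s_def by blast
    obtain n where n: "s = Suc n" using s gr0_implies_Suc by blast
    have "avoids {i, j, w} n X"
      unfolding avoids_def
    proof (intro allI impI)
      fix t assume "0 < t \<and> t \<le> n"
      then have "0 < t" "t < s" "t \<le> u" using n \<open>s \<le> u\<close> by auto
      then show "X t \<notin> {i, j, w}" using least[of t] others[of t] by simp
    qed
    moreover have "X (Suc n) = j" using s n by simp
    ultimately show "X \<in> (\<Union>n. first_passage {i, j, w} j n)"
      unfolding first_passage_def by blast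
  next
    assume "X \<in> (\<Union>n. first_passage {i, j, w} j n)"
    then obtain n where "avoids {i, j, w} n X" "X (Suc n) = j"
      by (auto simp: first_passage_def)
    moreover have "X t \<noteq> i \<and> X t \<noteq> w" if "0 < t" "t \<le> Suc n" for t
    proof (cases "t = Suc n")
      case True
      then show ?thesis using \<open>X (Suc n) = j\<close> assms by blast
    next
      case False
      then have "t \<le> n" using that by simp
      then show ?thesis
        using \<open>avoids {i, j, w} n X\<close> \<open>0 < t\<close> unfolding avoids_def by blast
    qed
    ultimately have "?ok (Suc n)" by blast
    then show "\<exists>s. ?ok s" ..
  qed
  finally show "X \<in> {X. return_time j X < min (return_time i X) (return_time w X)} \<longleftrightarrow>
    X \<in> (\<Union>n. first_passage {i, j, w} j n)" .
qed

lemma sum_option: "(\<Sum>x\<in>UNIV. f x) = f None + (\<Sum>k\<in>UNIV. f (Some k))"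
  for f :: "'a::finite option \<Rightarrow> real"
  by (simp add: UNIV_option_conv sum.reindex)

lemma absorbing_extension_nonneg: "substochastic S \<Longrightarrow> 0 \<le> absorbing_extension S x y"
  by (cases "(S, x, y)" rule: absorbing_extension.cases) (auto simp: substochastic_def)

lemma absorbing_extension_row_sum: "(\<Sum>y\<in>UNIV. absorbing_extension S x y) = 1"
  by (cases x) (simp_all add: sum_option)

lemma Q_prob_eq_first_passage:
  assumes "i \<noteq> j"
  shows "Q_prob S i j = measure (markov_law (absorbing_extension S) (Some i))
    (\<Union>n. first_passage {Some i, Some j, None} (Some j) n)"
  unfolding Q_prob_def
  by (subst return_before_eq_first_passage) (use assms in auto)

text \<open>A function that is harmonic for \<open>G\<close> and nonnegative is superharmonic for the smaller matrix \<open>S\<close>; it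
  remains so on the extended state space if it vanishes at the absorbing state.\<close>

lemma Q_prob_le:
  fixes S G :: "real ^ 'n ^ 'n"
  assumes S: "substochastic S" and "S \<le> G" and "i \<noteq> j"
    and q: "\<And>k. 0 \<le> q k" "q j = 1"
      "\<And>k. k \<noteq> i \<Longrightarrow> k \<noteq> j \<Longrightarrow> q k = (\<Sum>l\<in>UNIV. G $ k $ l * q l)"
  shows "Q_prob S i j \<le> (\<Sum>l\<in>UNIV. G $ i $ l * q l)"
proof -
  let ?q = "\<lambda>x. case x of None \<Rightarrow> 0 | Some k \<Rightarrow> q k"
  have le: "(\<Sum>x\<in>UNIV. absorbing_extension S (Some k) x * ?q x) \<le> (\<Sum>l\<in>UNIV. G $ k $ l * q l)" for k
    using \<open>S \<le> G\<close> q(1) by (auto simp: sum_option less_eq_vec_def intro!: sum_mono mult_right_mono)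
  have "Q_prob S i j \<le> (\<Sum>x\<in>UNIV. absorbing_extension S (Some i) x * ?q x)"
    unfolding Q_prob_eq_first_passage[OF \<open>i \<noteq> j\<close>]
  proof (rule prob_first_passage_le)
    fix x assume "x \<notin> {Some i, Some j, None}"
    then obtain k where "x = Some k" "k \<noteq> i" "k \<noteq> j" by (cases x) auto
    then show "(\<Sum>y\<in>UNIV. absorbing_extension S x y * ?q y) \<le> ?q x"
      using le[of k] q(3)[of k] by simp
  qed (use S q in \<open>auto simp: absorbing_extension_nonneg absorbing_extension_row_sum
      split: option.splits\<close>)
  with le[of i] show ?thesis by linarith
qed

lemma Q_prob_pos:
  fixes S :: "real ^ 'n ^ 'n"
  assumes S: "substochastic S" "irreducible_matrix S" and "i \<noteq> j"
  shows "Q_prob S i j > 0"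
  unfolding Q_prob_eq_first_passage[OF \<open>i \<noteq> j\<close>]
proof (rule prob_first_passage_pos)
  let ?r = "{(x, y). absorbing_extension S x y > 0 \<and>
      (y \<in> {Some i, Some j, None} \<longrightarrow> y = Some i \<or> y = Some j)}"
  have "(Some i, Some x) \<in> ?r\<^sup>*" if "(i, x) \<in> {(k, l). S $ k $ l \<noteq> 0}\<^sup>*" for x
    using that
  proof (induction rule: rtrancl_induct)
    case (step k l)
    then have "(Some k, Some l) \<in> ?r"
      using S(1) by (auto simp: substochastic_def less_le)
    with step.IH show ?case by (rule rtrancl_into_rtrancl)
  qed simp
  then show "(Some i, Some j) \<in> ?r\<^sup>*"
    using S by (simp add: irreducible_matrix_def)
qed (use S assms in \<open>auto simp: absorbing_extension_nonneg absorbing_extension_row_sum\<close>)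

section \<open>From single moves of mass to arbitrary perturbations\<close>

lemma row_sum_move_mass:
  assumes "i \<noteq> j"
  shows "(\<Sum>l\<in>UNIV. move_mass i j d G $ k $ l) = (\<Sum>l\<in>UNIV. G $ k $ l)"
proof -
  have "(\<Sum>l\<in>UNIV. of_bool (k = i) * d * (of_bool (l = j) - of_bool (l = i))) =
      of_bool (k = i) * d * ((\<Sum>l\<in>UNIV. of_bool (l = j)) - (\<Sum>l\<in>UNIV. of_bool (l = i)))"
    by (simp only: sum_distrib_left[symmetric] sum_subtractf)
  also have "\<dots> = 0" by (simp add: of_bool_def)
  finally show ?thesis by (simp add: move_mass_def sum.distrib)
qed

lemma diagonal_eq_if_row_sum_1:
  fixes G :: "real ^ 'n ^ 'n"
  assumes "(\<Sum>l\<in>UNIV. G $ k $ l) = 1"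
  shows "G $ k $ k = 1 - (\<Sum>l\<in>UNIV - {k}. G $ k $ l)"
  using assms by (simp add: sum_diff1)

lemmas stochastic_diagonal = diagonal_eq_if_row_sum_1[OF stochastic_row_sum]

lemma stochastic_eqI_off_diagonal:
  fixes F G :: "real ^ 'n ^ 'n"
  assumes F: "stochastic F" and G: "stochastic G" and off: "\<And>k l. k \<noteq> l \<Longrightarrow> G $ k $ l = F $ k $ l"
  shows "G = F"
proof -
  have "G $ k $ l = F $ k $ l" for k l
  proof (cases "k = l")
    case True
    have "(\<Sum>l\<in>UNIV - {k}. G $ k $ l) = (\<Sum>l\<in>UNIV - {k}. F $ k $ l)"
      by (rule sum.cong) (auto intro: off)
    then show ?thesis using True stochastic_diagonal[OF F, of k] stochastic_diagonal[OF G, of k] by simp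
  qed (rule off)
  then show ?thesis by (simp add: vec_eq_iff)
qed

text \<open>Here \<open>T\<close> contains the off-diagonal positions whose entries may still have to be raised from \<open>G\<close> to \<open>F\<close>.
  Raising one of them takes its mass from the diagonal. The diagonal entry stays above that of \<open>F\<close>, and
  so above that of \<open>S\<close>, because the off-diagonal entries stay below those of \<open>F\<close>.\<close>

lemma ln_invariant_distribution_increase:
  fixes F G S :: "real ^ 'n ^ 'n"
  assumes F: "stochastic F" and S: "substochastic S" "irreducible_matrix S" and SF: "S \<le> F"
    and "finite T" and G: "stochastic G" and SG: "S \<le> G"
    and off: "\<And>k l. (k, l) \<in> T \<Longrightarrow> k \<noteq> l"
    and le: "\<And>k l. (k, l) \<in> T \<Longrightarrow> G $ k $ l \<le> F $ k $ l"
    and eq: "\<And>k l. k \<noteq> l \<Longrightarrow> (k, l) \<notin> T \<Longrightarrow> G $ k $ l = F $ k $ l"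
  shows "\<bar>ln (invariant_distribution F $ m) - ln (invariant_distribution G $ m)\<bar>
    \<le> (\<Sum>(k, l)\<in>T. (F $ k $ l - G $ k $ l) / Q_prob S k l)"
  using \<open>finite T\<close> G SG off le eq
proof (induction T arbitrary: G rule: finite_induct)
  case empty
  then have "G = F" by (intro stochastic_eqI_off_diagonal[OF F]) auto
  then show ?case by simp
next
  case (insert ij T)
  obtain i j where ij: "ij = (i, j)" by (cases ij)
  note G = insert.prems(1) and SG = insert.prems(2) and off = insert.prems(3)
    and le = insert.prems(4) and eq = insert.prems(5)
  have "i \<noteq> j" and Gij: "G $ i $ j \<le> F $ i $ j" using off le by (auto simp: ij)
  define d where "d = F $ i $ j - G $ i $ j"
  define H where "H = move_mass i j d G"
  have "0 \<le> d" using Gij by (simp add: d_def)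
  have H_ij: "H $ i $ j = F $ i $ j"
    and H_other: "k \<noteq> l \<Longrightarrow> (k, l) \<noteq> (i, j) \<Longrightarrow> H $ k $ l = G $ k $ l"
    and H_diag: "k \<noteq> i \<Longrightarrow> H $ k $ k = G $ k $ k" for k l
    using \<open>i \<noteq> j\<close> by (auto simp: H_def move_mass_def d_def)
  have "H $ k $ l \<le> F $ k $ l" if "k \<noteq> l" for k l
  proof (cases "(k, l) \<in> insert ij T")
    case True
    then show ?thesis using le[of k l] H_ij H_other[OF that] ij by (cases "(k, l) = (i, j)") auto
  next
    case False
    then show ?thesis using eq[OF that] H_other[OF that] ij by auto
  qed
  then have "(\<Sum>l\<in>UNIV - {i}. H $ i $ l) \<le> (\<Sum>l\<in>UNIV - {i}. F $ i $ l)"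
    by (intro sum_mono) auto
  moreover have H_row: "(\<Sum>l\<in>UNIV. H $ k $ l) = 1" for k
    using row_sum_move_mass[OF \<open>i \<noteq> j\<close>, of d G k] stochastic_row_sum[OF G] by (simp add: H_def)
  ultimately have F_ii: "F $ i $ i \<le> H $ i $ i"
    using stochastic_diagonal[OF F, of i] diagonal_eq_if_row_sum_1[of H i, OF H_row] by linarith
  have SH_entry: "S $ k $ l \<le> H $ k $ l" for k l
  proof -
    have "S $ k $ l \<le> F $ k $ l" "S $ k $ l \<le> G $ k $ l"
      using SF SG by (auto simp: less_eq_vec_def)
    then show ?thesis
      using F_ii H_ij H_other[of k l] H_diag[of k]
      by (cases "k = l"; cases "(k, l) = (i, j)"; cases "k = i") auto
  qed
  then have SH: "S \<le> H" by (simp add: less_eq_vec_def)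
  have "0 \<le> H $ k $ l" for k l
    using SH_entry[of k l] S(1) by (auto simp: substochastic_def intro: order_trans)
  then have H: "stochastic H" using H_row by (simp add: stochastic_def)
  have irr: "irreducible_matrix G" "irreducible_matrix H"
    using irreducible_matrix_mono[OF S(2,1)] SG SH by auto
  obtain q where q: "\<And>k. 0 \<le> q k" "q j = 1" "q i = 0"
      "\<And>k. k \<noteq> i \<Longrightarrow> k \<noteq> j \<Longrightarrow> q k = (\<Sum>l\<in>UNIV. G $ k $ l * q l)"
    using harmonic_function_exists[of "\<lambda>k l. G $ k $ l" j i] G \<open>i \<noteq> j\<close>
    unfolding stochastic_def by metis
  let ?Q = "\<Sum>k\<in>UNIV. G $ i $ k * q k"
  have Q: "0 < Q_prob S i j" "Q_prob S i j \<le> ?Q"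
    using Q_prob_pos[OF S \<open>i \<noteq> j\<close>] Q_prob_le[OF S(1) SG \<open>i \<noteq> j\<close> q(1,2,4)] by auto
  have "\<bar>ln (invariant_distribution H $ m) - ln (invariant_distribution G $ m)\<bar> \<le> d / ?Q"
    unfolding H_def
    by (rule ln_invariant_distribution_move_mass[OF G irr(1)])
      (use H irr(2) \<open>i \<noteq> j\<close> \<open>0 \<le> d\<close> q Q in \<open>auto simp: H_def\<close>)
  also have "\<dots> \<le> d / Q_prob S i j"
    using Q \<open>0 \<le> d\<close> by (intro divide_left_mono) auto
  finally have first: "\<bar>ln (invariant_distribution H $ m) - ln (invariant_distribution G $ m)\<bar>
    \<le> d / Q_prob S i j" .
  have "\<bar>ln (invariant_distribution F $ m) - ln (invariant_distribution H $ m)\<bar>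
      \<le> (\<Sum>(k, l)\<in>T. (F $ k $ l - H $ k $ l) / Q_prob S k l)"
  proof (rule insert.IH[OF H SH])
    fix k l
    show "(k, l) \<in> T \<Longrightarrow> k \<noteq> l" using off by auto
    show "(k, l) \<in> T \<Longrightarrow> H $ k $ l \<le> F $ k $ l"
      using \<open>\<And>k l. k \<noteq> l \<Longrightarrow> H $ k $ l \<le> F $ k $ l\<close> off by auto
    show "k \<noteq> l \<Longrightarrow> (k, l) \<notin> T \<Longrightarrow> H $ k $ l = F $ k $ l"
      using eq[of k l] H_ij H_other[of k l] ij by (cases "(k, l) = (i, j)") auto
  qed
  also have "\<dots> = (\<Sum>(k, l)\<in>T. (F $ k $ l - G $ k $ l) / Q_prob S k l)"
  proof (rule sum.cong[OF refl])
    fix x assume x: "x \<in> T"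
    obtain k l where kl: "x = (k, l)" by (cases x)
    have "k \<noteq> l" "(k, l) \<noteq> (i, j)" using x kl off insert.hyps ij by auto
    then show "(case x of (k, l) \<Rightarrow> (F $ k $ l - H $ k $ l) / Q_prob S k l) =
        (case x of (k, l) \<Rightarrow> (F $ k $ l - G $ k $ l) / Q_prob S k l)"
      using H_other[of k l] kl by simp
  qed
  finally show ?case
    using first insert.hyps by (simp add: ij d_def)
qed

theorem corollary2:
  fixes F F' S :: "real ^ 'n ^ 'n" and m :: 'n
  assumes "stochastic F" and "stochastic F'"
    and "substochastic S" and "irreducible_matrix S"
    and "S \<le> F" and "S \<le> F'"
  shows "\<bar>ln (invariant_distribution F' $ m) - ln (invariant_distribution F $ m)\<bar>
    \<le> (\<Sum>(i, j) \<in> {(i, j). i \<noteq> j}. \<bar>F' $ i $ j - F $ i $ j\<bar> / Q_prob S i j)"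
proof -
  let ?off = "{(i, j). i \<noteq> j} :: ('n \<times> 'n) set"
  define \<mu> where "\<mu> i j = min (F $ i $ j) (F' $ i $ j)" for i j
  define G :: "real ^ 'n ^ 'n" where
    "G = (\<chi> i j. if i = j then 1 - (\<Sum>l\<in>UNIV - {i}. \<mu> i l) else \<mu> i j)"
  have G_off: "G $ i $ j = \<mu> i j" if "i \<noteq> j" for i j
    using that by (simp add: G_def)
  have G_row: "(\<Sum>j\<in>UNIV. G $ i $ j) = 1" for i
  proof -
    have "(\<Sum>j\<in>UNIV. G $ i $ j) = G $ i $ i + (\<Sum>j\<in>UNIV - {i}. G $ i $ j)"
      by (rule sum.remove) auto
    also have "(\<Sum>j\<in>UNIV - {i}. G $ i $ j) = (\<Sum>j\<in>UNIV - {i}. \<mu> i j)"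
      by (rule sum.cong) (auto simp: G_off)
    finally show ?thesis by (simp add: G_def)
  qed
  have G_diag: "F $ i $ i \<le> G $ i $ i" for i
  proof -
    have "(\<Sum>l\<in>UNIV - {i}. \<mu> i l) \<le> (\<Sum>l\<in>UNIV - {i}. F $ i $ l)"
      by (rule sum_mono) (simp add: \<mu>_def)
    then show ?thesis using stochastic_diagonal[OF assms(1), of i] by (simp add: G_def)
  qed
  have S_entry: "S $ i $ j \<le> G $ i $ j" for i j
  proof -
    have "S $ i $ j \<le> F $ i $ j" "S $ i $ j \<le> F' $ i $ j"
      using assms by (auto simp: less_eq_vec_def)
    then show ?thesis
      using G_off[of i j] G_diag[of i] by (cases "i = j") (auto simp: \<mu>_def intro: order_trans)
  qed
  have G: "stochastic G"
  proof -
    have "0 \<le> G $ i $ j" for i j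
      using S_entry[of i j] assms(3) by (auto simp: substochastic_def intro: order_trans)
    then show ?thesis using G_row by (simp add: stochastic_def)
  qed
  have bound: "\<bar>ln (invariant_distribution E $ m) - ln (invariant_distribution G $ m)\<bar>
      \<le> (\<Sum>(i, j)\<in>?off. (E $ i $ j - \<mu> i j) / Q_prob S i j)"
    if "stochastic E" "S \<le> E" "\<And>i j. \<mu> i j \<le> E $ i $ j" for E
  proof -
    have "\<bar>ln (invariant_distribution E $ m) - ln (invariant_distribution G $ m)\<bar>
        \<le> (\<Sum>(i, j)\<in>?off. (E $ i $ j - G $ i $ j) / Q_prob S i j)"
      by (rule ln_invariant_distribution_increase[OF that(1) assms(3,4) that(2) _ G])
        (use S_entry G_off that(3) in \<open>auto simp: less_eq_vec_def\<close>)
    also have "\<dots> = (\<Sum>(i, j)\<in>?off. (E $ i $ j - \<mu> i j) / Q_prob S i j)"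
      by (rule sum.cong) (auto simp: G_off)
    finally show ?thesis .
  qed
  have "\<bar>ln (invariant_distribution F' $ m) - ln (invariant_distribution F $ m)\<bar>
      \<le> (\<Sum>(i, j)\<in>?off. (F' $ i $ j - \<mu> i j) / Q_prob S i j)
        + (\<Sum>(i, j)\<in>?off. (F $ i $ j - \<mu> i j) / Q_prob S i j)"
    using bound[of F'] bound[of F] assms by (simp add: \<mu>_def)
  also have "\<dots> = (\<Sum>(i, j)\<in>?off. \<bar>F' $ i $ j - F $ i $ j\<bar> / Q_prob S i j)"
    unfolding sum.distrib[symmetric]
    by (rule sum.cong) (auto simp: \<mu>_def min_def add_divide_distrib[symmetric])
  finally show ?thesis .
qed

end
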